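(* Let $(V_i,v_i,\varphi^{(i)})_{i\in I}$ be a fusion frame system for $\mathcal{H}$ and let $v\varphi=(v_i\varphi_{ij})_{i\in I,j\in J_i}$ be its corresponding global frame. If $V=(V_i,v_i)_{i\in I}$ is a fusion Riesz basis, then $(S_V^{-1}S_{\varphi^{(i)}}^{-1}v_i\varphi_{ij})_{i\in I,j\in J_i}$ is the canonical dual frame of $v\varphi$, i.e. $$(S_{v\varphi}^{-1}v_i\varphi_{ij})_{i\in I,j\in J_i}=(S_V^{-1}S_{\varphi^{(i)}}^{-1}v_i\varphi_{ij})_{i\in I,j\in J_i}.$$
   Context: $\mathcal{H}$ is a separable Hilbert space; $\pi_U$ denotes the orthogonal projection onto a closed subspace $U$. A frame for a Hilbert space $K$ is a countable family $\psi=(\psi_j)_{j\in J}$ in $K$ with constants $0<A\le B<\infty$ (frame bounds) such that $A\|f\|^2\le\sum_j|\langle f,\psi_j\rangle|^2\le B\|f\|^2$ for all $f\in K$; its frame operator $S_\psi f=\sum_j\langle f,\psi_j\rangle\psi_j$ is bounded, positive and invertible on $K$, and $(S_\psi^{-1}\psi_j)_{j\in J}$ is its canonical dual frame. A fusion frame for $\mathcal{H}$ is a countable family $V=(V_i,v_i)_{i\in I}$ of closed subspaces $V_i\subseteq\mathcal{H}$ with weights $v_i>0$ for which there are constants $0<A_V\le B_V<\infty$ with $A_V\|f\|^2\le\sum_{i} v_i^2\|\pi_{V_i}f\|^2\le B_V\|f\|^2$ for all $f\in\mathcal{H}$; its fusion frame operator $S_Vf=\sum_iv_i^2\pi_{V_i}f$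 is bounded, positive and invertible on $\mathcal{H}$. A fusion frame system $(V_i,v_i,\varphi^{(i)})_{i\in I}$ for $\mathcal{H}$ consists of a fusion frame $(V_i,v_i)_{i\in I}$ for $\mathcal{H}$ and, for every $i\in I$, a frame $\varphi^{(i)}=(\varphi_{ij})_{j\in J_i}$ for $V_i$ (local frame), such that the local frames have common frame bounds $0<A\le B<\infty$. Its global frame is the family $v\varphi=(v_i\varphi_{ij})_{i\in I,j\in J_i}$, which is a frame for $\mathcal{H}$. The operator $S_{\varphi^{(i)}}$ acts on $V_i$. A family $(V_i,v_i)_{i\in I}$ of closed subspaces with weights $v_i>0$ is a fusion Riesz basis for $\mathcal{H}$ if the closed linear span of $\bigcup_i V_i$ is $\mathcal{H}$ and there are constants $0<\alpha_V\le\beta_V<\infty$ such that for every finite $J\subseteq I$ and all $f_j\in V_j$ ($j\in J$): $\alpha_V\sum_{j\in J}\|f_j\|^2\le\|\sum_{j\in J}v_jf_j\|^2\le\beta_V\sum_{j\in J}\|f_j\|^2$. *)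

theory Defs
  imports "HOL-Analysis.Analysis"
begin

(* The scalar field is left open, so that real and complex Hilbert spaces are treated
   simultaneously. Up to isomorphism the only models of this class are the reals with the identity
   and the complex numbers with cnj: an element fixed by scalar_conj is real, so every x is a root of
   the real polynomial X^2 - (x + scalar_conj x) X + x * scalar_conj x. *)
class rc_field = real_normed_field +
  fixes scalar_conj :: "'a \<Rightarrow> 'a"
  assumes scalar_conj_add: "scalar_conj (x + y) = scalar_conj x + scalar_conj y"
    and scalar_conj_mult: "scalar_conj (x * y) = scalar_conj x * scalar_conj y"
    and mult_scalar_conj: "x * scalar_conj x = (norm x)\<^sup>2 *\<^sub>R 1"

instantiation real :: rc_field
begin
definition scalar_conj_real :: "real \<Rightarrow> real" where "scalar_conj_real x = x"
instance by standard (auto simp: scalar_conj_real_def power2_eq_square)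
end

instantiation complex :: rc_field
begin
definition scalar_conj_complex :: "complex \<Rightarrow> complex" where "scalar_conj_complex = cnj"
instance
proof
  fix x :: complex
  show "x * scalar_conj x = (norm x)\<^sup>2 *\<^sub>R 1"
    unfolding scalar_conj_complex_def scaleR_conv_of_real mult_1_right by (rule complex_norm_square[symmetric])
qed (simp_all add: scalar_conj_complex_def)
end

(* A separable Hilbert space over 'k. Norm, topology and completeness come from the type class;
   by ip_self and polarization the real inner product of the class is the real part of ip.
   The form ip is linear in its first argument. *)
locale separable_hilbert_space = vector_space scl
  for scl :: "'k::rc_field \<Rightarrow> 'h::{real_inner, complete_space} \<Rightarrow> 'h" +
  fixes ip :: "'h \<Rightarrow> 'h \<Rightarrow> 'k"
  assumes scl_of_real: "scl (of_real r) x = r *\<^sub>R x"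
    and ip_add_left: "ip (x + y) z = ip x z + ip y z"
    and ip_scl_left: "ip (scl c x) y = c * ip x y"
    and ip_commute: "ip y x = scalar_conj (ip x y)"
    and ip_self: "ip x x = of_real ((norm x)\<^sup>2)"
    and separable: "separable_space (euclidean :: 'h topology)"

lemma separable_hilbert_space_real:
  assumes "separable_space (euclidean :: 'h::{real_inner, complete_space} topology)"
  shows "separable_hilbert_space (scaleR :: real \<Rightarrow> 'h \<Rightarrow> 'h) inner"
proof unfold_locales
  fix x y :: 'h
  show "inner y x = scalar_conj (inner x y)"
    unfolding scalar_conj_real_def by (rule inner_commute)
qed (use assms in \<open>simp_all add: scaleR_add_left scaleR_add_right inner_add_left
  power2_norm_eq_inner\<close>)

lemma separable_hilbert_space_complex:
  "separable_hilbert_space (*) (\<lambda>x y :: complex. x * cnj y)"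
proof unfold_locales
  obtain D :: "complex set" where "countable D" "UNIV \<subseteq> closure D"
    using separable[of "UNIV :: complex set"] by metis
  then show "separable_space (euclidean :: complex topology)"
    unfolding separable_space_def by (intro exI[of _ D]) auto
next
  fix x :: complex
  show "x * cnj x = of_real ((norm x)\<^sup>2)"
    by (rule complex_norm_square[symmetric])
qed (simp_all add: distrib_left distrib_right scalar_conj_complex_def scaleR_conv_of_real mult.commute)

definition closed_subspace :: "('k::field \<Rightarrow> 'h::real_normed_vector \<Rightarrow> 'h) \<Rightarrow> 'h set \<Rightarrow> bool"
  where "closed_subspace scl U \<longleftrightarrow> module.subspace scl U \<and> closed U"

definition orth_proj :: "('h \<Rightarrow> 'h \<Rightarrow> 'k::rc_field) \<Rightarrow> 'h set \<Rightarrow> 'h \<Rightarrow> 'h::real_inner"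
  where "orth_proj ip U f = (THE p. p \<in> U \<and> (\<forall>u\<in>U. ip (f - p) u = 0))"

(* Summability has to be required separately here and below, as infsum is 0 for families that are
   not summable. *)
definition frame_with_bounds ::
    "('h \<Rightarrow> 'h \<Rightarrow> 'k::rc_field) \<Rightarrow> real \<Rightarrow> real \<Rightarrow> 'h::real_inner set \<Rightarrow> 'j set \<Rightarrow> ('j \<Rightarrow> 'h) \<Rightarrow> bool"
  where "frame_with_bounds ip A B K J \<psi> \<longleftrightarrow>
    countable J \<and> 0 < A \<and> A \<le> B \<and> (\<forall>j\<in>J. \<psi> j \<in> K) \<and>
    (\<forall>f\<in>K. (\<lambda>j. (norm (ip f (\<psi> j)))\<^sup>2) summable_on J \<and>
       A * (norm f)\<^sup>2 \<le> (\<Sum>\<^sub>\<infinity>j\<in>J. (norm (ip f (\<psi> j)))\<^sup>2) \<and>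
       (\<Sum>\<^sub>\<infinity>j\<in>J. (norm (ip f (\<psi> j)))\<^sup>2) \<le> B * (norm f)\<^sup>2)"

definition is_frame ::
    "('h \<Rightarrow> 'h \<Rightarrow> 'k::rc_field) \<Rightarrow> 'h::real_inner set \<Rightarrow> 'j set \<Rightarrow> ('j \<Rightarrow> 'h) \<Rightarrow> bool"
  where "is_frame ip K J \<psi> \<longleftrightarrow> (\<exists>A B. frame_with_bounds ip A B K J \<psi>)"

definition frame_operator ::
    "('k::rc_field \<Rightarrow> 'h \<Rightarrow> 'h) \<Rightarrow> ('h \<Rightarrow> 'h \<Rightarrow> 'k) \<Rightarrow> 'j set \<Rightarrow> ('j \<Rightarrow> 'h) \<Rightarrow> 'h \<Rightarrow> 'h::real_inner"
  where "frame_operator scl ip J \<psi> f = (\<Sum>\<^sub>\<infinity>j\<in>J. scl (ip f (\<psi> j)) (\<psi> j))"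

(* For a frame of a closed subspace K the frame operator is a bijection of K onto K, and its
   inverse is the one of this restriction to K. *)
definition frame_operator_inv ::
    "('k::rc_field \<Rightarrow> 'h \<Rightarrow> 'h) \<Rightarrow> ('h \<Rightarrow> 'h \<Rightarrow> 'k) \<Rightarrow> 'h set \<Rightarrow> 'j set \<Rightarrow> ('j \<Rightarrow> 'h) \<Rightarrow> 'h \<Rightarrow> 'h::real_inner"
  where "frame_operator_inv scl ip K J \<psi> = inv_into K (frame_operator scl ip J \<psi>)"

definition canonical_dual ::
    "('k::rc_field \<Rightarrow> 'h \<Rightarrow> 'h) \<Rightarrow> ('h \<Rightarrow> 'h \<Rightarrow> 'k) \<Rightarrow> 'h set \<Rightarrow> 'j set \<Rightarrow> ('j \<Rightarrow> 'h) \<Rightarrow> 'j \<Rightarrow> 'h::real_inner"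
  where "canonical_dual scl ip K J \<psi> j = frame_operator_inv scl ip K J \<psi> (\<psi> j)"

definition fusion_frame ::
    "('k::rc_field \<Rightarrow> 'h \<Rightarrow> 'h) \<Rightarrow> ('h \<Rightarrow> 'h \<Rightarrow> 'k) \<Rightarrow> 'i set \<Rightarrow> ('i \<Rightarrow> 'h::real_inner set) \<Rightarrow> ('i \<Rightarrow> real) \<Rightarrow> bool"
  where "fusion_frame scl ip I V v \<longleftrightarrow>
    countable I \<and> (\<forall>i\<in>I. closed_subspace scl (V i) \<and> 0 < v i) \<and>
    (\<exists>A B. 0 < A \<and> A \<le> B \<and>
      (\<forall>f. (\<lambda>i. (v i)\<^sup>2 * (norm (orth_proj ip (V i) f))\<^sup>2) summable_on I \<and>
         A * (norm f)\<^sup>2 \<le> (\<Sum>\<^sub>\<infinity>i\<in>I. (v i)\<^sup>2 * (norm (orth_proj ip (V i) f))\<^sup>2) \<and>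
         (\<Sum>\<^sub>\<infinity>i\<in>I. (v i)\<^sup>2 * (norm (orth_proj ip (V i) f))\<^sup>2) \<le> B * (norm f)\<^sup>2))"

definition fusion_frame_operator ::
    "('h \<Rightarrow> 'h \<Rightarrow> 'k::rc_field) \<Rightarrow> 'i set \<Rightarrow> ('i \<Rightarrow> 'h set) \<Rightarrow> ('i \<Rightarrow> real) \<Rightarrow> 'h \<Rightarrow> 'h::real_inner"
  where "fusion_frame_operator ip I V v f = (\<Sum>\<^sub>\<infinity>i\<in>I. (v i)\<^sup>2 *\<^sub>R orth_proj ip (V i) f)"

definition fusion_frame_system ::
    "('k::rc_field \<Rightarrow> 'h \<Rightarrow> 'h) \<Rightarrow> ('h \<Rightarrow> 'h \<Rightarrow> 'k) \<Rightarrow> 'i set \<Rightarrow> ('i \<Rightarrow> 'h::real_inner set) \<Rightarrow> ('i \<Rightarrow> real) \<Rightarrow>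
      ('i \<Rightarrow> 'j set) \<Rightarrow> ('i \<Rightarrow> 'j \<Rightarrow> 'h) \<Rightarrow> bool"
  where "fusion_frame_system scl ip I V v J \<phi> \<longleftrightarrow>
    fusion_frame scl ip I V v \<and>
    (\<exists>A B. 0 < A \<and> A \<le> B \<and> (\<forall>i\<in>I. frame_with_bounds ip A B (V i) (J i) (\<phi> i)))"

definition global_frame :: "('i \<Rightarrow> real) \<Rightarrow> ('i \<Rightarrow> 'j \<Rightarrow> 'h) \<Rightarrow> 'i \<times> 'j \<Rightarrow> 'h::real_inner"
  where "global_frame v \<phi> = (\<lambda>(i, j). v i *\<^sub>R \<phi> i j)"

definition fusion_riesz_basis ::
    "('k::rc_field \<Rightarrow> 'h \<Rightarrow> 'h) \<Rightarrow> 'i set \<Rightarrow> ('i \<Rightarrow> 'h::real_inner set) \<Rightarrow> ('i \<Rightarrow> real) \<Rightarrow> bool"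
  where "fusion_riesz_basis scl I V v \<longleftrightarrow>
    (\<forall>i\<in>I. closed_subspace scl (V i) \<and> 0 < v i) \<and>
    closure (module.span scl (\<Union>i\<in>I. V i)) = UNIV \<and>
    (\<exists>\<alpha> \<beta>. 0 < \<alpha> \<and> \<alpha> \<le> \<beta> \<and>
      (\<forall>F f. finite F \<and> F \<subseteq> I \<and> (\<forall>j\<in>F. f j \<in> V j) \<longrightarrow>
         \<alpha> * (\<Sum>j\<in>F. (norm (f j))\<^sup>2) \<le> (norm (\<Sum>j\<in>F. v j *\<^sub>R f j))\<^sup>2 \<and>
         (norm (\<Sum>j\<in>F. v j *\<^sub>R f j))\<^sup>2 \<le> \<beta> * (\<Sum>j\<in>F. (norm (f j))\<^sup>2)))"

end

theory Submission
  imports Defs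
begin

text \<open>Write \<open>\<pi>\<^sub>k\<close> for the projection onto \<open>V\<^sub>k\<close>, and let \<open>f \<in> V\<^sub>i\<close> and \<open>h = S\<^sub>V\<inverse> f\<close>. Then \<open>f = \<Sum>\<^sub>k v\<^sub>k\<^sup>2 \<pi>\<^sub>k h\<close>, and
  uniqueness of expansions in a fusion Riesz basis forces \<open>\<pi>\<^sub>k h = 0\<close> for \<open>k \<noteq> i\<close> and
  \<open>v\<^sub>i\<^sup>2 \<pi>\<^sub>i h = f\<close>. Only the terms with index \<open>i\<close> survive in the global frame operator at \<open>h\<close>, and
  they sum to the value of the local frame operator at \<open>v\<^sub>i\<^sup>2 \<pi>\<^sub>i h = f\<close>. For
  \<open>f = S\<inverse> v\<^sub>i \<phi>\<^sub>i\<^sub>j\<close> with \<open>S\<close> the local frame operator this value is \<open>v\<^sub>i \<phi>\<^sub>i\<^sub>j\<close>, and the global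
  frame operator is injective.\<close>

section \<open>Summation and coercive operators in Hilbert spaces\<close>

lemma has_sum_diff:
  fixes f g :: "'a \<Rightarrow> 'b::real_normed_vector"
  assumes "(f has_sum a) A" and "(g has_sum b) A"
  shows "((\<lambda>x. f x - g x) has_sum (a - b)) A"
  using has_sum_add[OF assms(1), of "\<lambda>x. - g x" "- b"] assms(2)
  by (simp add: has_sum_uminus)

text \<open>Cauchy criterion: the bound applied to \<open>F - F0\<close> controls the distance of
  two partial sums by a tail of the convergent series \<open>a\<close>, and completeness gives the
  limit. This covers frame expansions, whose terms need not be absolutely summable.\<close>

lemma summable_on_norm_square_bound:
  fixes g :: "'a \<Rightarrow> 'b::{real_normed_vector, complete_space}" and a :: "'a \<Rightarrow> real"
  assumes a: "a summable_on A" and nonneg: "\<And>x. x \<in> A \<Longrightarrow> 0 \<le> a x" and C: "0 \<le> C"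
    and bound: "\<And>F. finite F \<Longrightarrow> F \<subseteq> A \<Longrightarrow> (norm (sum g F))\<^sup>2 \<le> C * sum a F"
  shows "g summable_on A" and "(norm (infsum g A))\<^sup>2 \<le> C * infsum a A"
proof -
  have "\<exists>P. eventually P (finite_subsets_at_top A) \<and>
      (\<forall>F F'. P F \<and> P F' \<longrightarrow> dist (sum g F) (sum g F') < e)" if "0 < e" for e
  proof -
    \<comment> \<open>Dividing by \<open>C + 1\<close> rather than by \<open>C\<close> also covers
      the case \<open>C = 0\<close>.\<close>
    define d where "d = (e / 2)\<^sup>2 / (C + 1)"
    have d: "0 < d" "C * d < (e / 2)\<^sup>2"
      using \<open>0 < e\<close> C by (auto simp: d_def field_simps)
    obtain F0 where F0: "finite F0" "F0 \<subseteq> A" "dist (sum a F0) (infsum a A) \<le> d"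
      using infsum_finite_approximation[OF a d(1)] by blast
    have tail: "dist (sum g F) (sum g F0) < e / 2" if F: "finite F" "F0 \<subseteq> F" "F \<subseteq> A" for F
    proof -
      have "(dist (sum g F) (sum g F0))\<^sup>2 = (norm (sum g (F - F0)))\<^sup>2"
        using F by (simp add: dist_norm sum_diff)
      also have "\<dots> \<le> C * sum a (F - F0)"
        using F by (intro bound) auto
      also have "sum a (F - F0) \<le> d"
        using finite_sum_le_infsum[OF a F(1) F(3)] nonneg F0(3) F
        by (auto simp: sum_diff dist_real_def)
      then have "C * sum a (F - F0) \<le> C * d"
        using C by (rule mult_left_mono)
      also note d(2)
      finally show ?thesis
        by (rule power_less_imp_less_base) (use \<open>0 < e\<close> in simp)
    qed
    have "eventually (\<lambda>F. finite F \<and> F0 \<subseteq> F \<and> F \<subseteq> A) (finite_subsets_at_top A)"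
      using F0 by (auto simp: eventually_finite_subsets_at_top)
    moreover have "dist (sum g F) (sum g F') < e"
      if "finite F \<and> F0 \<subseteq> F \<and> F \<subseteq> A" "finite F' \<and> F0 \<subseteq> F' \<and> F' \<subseteq> A" for F F'
      using tail[of F] tail[of F'] that dist_triangle_half_l by blast
    ultimately show ?thesis
      by (intro exI[of _ "\<lambda>F. finite F \<and> F0 \<subseteq> F \<and> F \<subseteq> A"] conjI allI impI) simp_all
  qed
  then have "cauchy_filter (filtermap (sum g) (finite_subsets_at_top A))"
    by (simp add: cauchy_filter_metric_filtermap)
  moreover have "complete (UNIV :: 'b set)"
    by (rule complete_UNIV)
  ultimately obtain L where "(sum g \<longlongrightarrow> L) (finite_subsets_at_top A)"
    using complete_uniform[where S=UNIV] by (force simp add: filterlim_def)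
  then show g: "g summable_on A"
    by (auto simp: summable_on_def has_sum_def)
  show "(norm (infsum g A))\<^sup>2 \<le> C * infsum a A"
  proof (rule tendsto_le)
    show "((\<lambda>F. (norm (sum g F))\<^sup>2) \<longlongrightarrow> (norm (infsum g A))\<^sup>2) (finite_subsets_at_top A)"
      by (intro tendsto_intros infsum_tendsto g)
    show "((\<lambda>F. C * sum a F) \<longlongrightarrow> C * infsum a A) (finite_subsets_at_top A)"
      by (intro tendsto_intros infsum_tendsto a)
    show "\<forall>\<^sub>F F in finite_subsets_at_top A. (norm (sum g F))\<^sup>2 \<le> C * sum a F"
      by (intro eventually_finite_subsets_at_top_weakI bound)
  qed simp
qed

text \<open>For small \<open>t > 0\<close> the map \<open>x \<mapsto> x - t (T x - y)\<close> is a contraction.\<close>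
lemma coercive_surj:
  fixes T :: "'h::{real_inner, complete_space} \<Rightarrow> 'h"
  assumes K: "subspace K" "closed K" and TK: "\<And>x. x \<in> K \<Longrightarrow> T x \<in> K"
    and diff: "\<And>x y. x \<in> K \<Longrightarrow> y \<in> K \<Longrightarrow> T (x - y) = T x - T y"
    and bounded: "0 \<le> M" "\<And>x. x \<in> K \<Longrightarrow> (norm (T x))\<^sup>2 \<le> M * (norm x)\<^sup>2"
    and coercive: "0 < A" "\<And>x. x \<in> K \<Longrightarrow> A * (norm x)\<^sup>2 \<le> inner (T x) x"
    and y: "y \<in> K"
  shows "\<exists>x\<in>K. T x = y"
proof -
  \<comment> \<open>\<open>N\<close> dominates both \<open>M\<close> and \<open>A\<^sup>2\<close>.
    The choice \<open>t = A / N\<close> minimises \<open>1 - 2 * (t * A) + t\<^sup>2 * N\<close>,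
    and the minimum \<open>1 - A\<^sup>2 / N\<close> lies in [0, 1), so its root \<open>c\<close> is
    a contraction constant.\<close>
  define N where "N = M + A\<^sup>2"
  define t where "t = A / N"
  define c where "c = sqrt (1 - A\<^sup>2 / N)"
  have N: "0 < N" "A\<^sup>2 \<le> N" "M \<le> N"
    using bounded(1) coercive(1) by (auto simp: N_def add_nonneg_pos)
  have t: "0 < t" "t * A = A\<^sup>2 / N" "t\<^sup>2 * N = A\<^sup>2 / N"
    using N coercive(1) by (auto simp: t_def power2_eq_square field_simps)
  have c: "0 \<le> c" "c < 1" "c\<^sup>2 = 1 - A\<^sup>2 / N"
    using N coercive(1) by (auto simp: c_def field_simps)
  have contract: "norm (x - t *\<^sub>R T x) \<le> c * norm x" if "x \<in> K" for x
  proof (rule power2_le_imp_le)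
    have "(norm (T x))\<^sup>2 \<le> N * (norm x)\<^sup>2"
      by (rule order.trans[OF bounded(2)[OF that]]) (intro mult_right_mono N(3), simp)
    then have *: "t\<^sup>2 * (norm (T x))\<^sup>2 \<le> t\<^sup>2 * (N * (norm x)\<^sup>2)"
      by (intro mult_left_mono) auto
    have **: "2 * t * (A * (norm x)\<^sup>2) \<le> 2 * t * inner (T x) x"
      using coercive(2)[OF that] t(1) by (intro mult_left_mono) auto
    have "(norm (x - t *\<^sub>R T x))\<^sup>2 = (norm x)\<^sup>2 - 2 * t * inner (T x) x + t\<^sup>2 * (norm (T x))\<^sup>2"
      unfolding power2_norm_eq_inner
      by (simp add: inner_diff_left inner_diff_right inner_commute power2_eq_square algebra_simps)
    also have "\<dots> \<le> (norm x)\<^sup>2 - 2 * t * (A * (norm x)\<^sup>2) + t\<^sup>2 * (N * (norm x)\<^sup>2)"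
      using * ** by linarith
    also have "\<dots> = (1 - 2 * (t * A) + t\<^sup>2 * N) * (norm x)\<^sup>2"
      by (simp add: algebra_simps)
    also have "\<dots> = (c * norm x)\<^sup>2"
      unfolding t c(3) power_mult_distrib by simp
    finally show "(norm (x - t *\<^sub>R T x))\<^sup>2 \<le> (c * norm x)\<^sup>2" .
  qed (use c in simp)
  \<comment> \<open>As \<open>t > 0\<close>, the fixed points are exactly the solutions of
    \<open>T x = y\<close>. The constant \<open>y\<close> cancels in differences, so
    \<open>contract\<close> at \<open>x - z\<close> gives the Lipschitz bound.\<close>
  have "\<exists>!x\<in>K. x - t *\<^sub>R (T x - y) = x"
  proof (rule Banach_fix[OF _ _ c(1,2)])
    show "complete K"
      using K(2) complete_eq_closed by blast
    show "K \<noteq> {}"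
      using y by blast
    show "(\<lambda>x. x - t *\<^sub>R (T x - y)) ` K \<subseteq> K"
      using K(1) TK y by (auto intro!: subspace_diff subspace_scale)
    fix x z assume xz: "x \<in> K" "z \<in> K"
    have "x - t *\<^sub>R (T x - y) - (z - t *\<^sub>R (T z - y)) = (x - z) - t *\<^sub>R T (x - z)"
      unfolding diff[OF xz] by (simp add: algebra_simps)
    then show "dist (x - t *\<^sub>R (T x - y)) (z - t *\<^sub>R (T z - y)) \<le> c * dist x z"
      unfolding dist_norm using contract[OF subspace_diff[OF K(1) xz]] by (simp only:)
  qed
  then show ?thesis
    using t(1) by auto
qed

section \<open>The scalar-valued inner product\<close>

lemma scalar_conj_0: "scalar_conj (0 :: 'k::rc_field) = 0"
  using scalar_conj_add[of "0 :: 'k" 0] by simp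

text \<open>That conjugation fixes real scalars is not an axiom of the class; it follows by
  cancelling \<open>of_real r\<close> in \<open>mult_scalar_conj\<close>, with 0 treated
  separately.\<close>

lemma scalar_conj_of_real: "scalar_conj (of_real r) = (of_real r :: 'k::rc_field)"
proof (cases "r = 0")
  case False
  have "of_real r * scalar_conj (of_real r) = (of_real r * of_real r :: 'k)"
    unfolding mult_scalar_conj by (simp add: scaleR_conv_of_real power2_eq_square)
  with False show ?thesis
    by simp
qed (simp add: scalar_conj_0)

lemma norm_scalar_conj: "norm (scalar_conj c) = norm (c :: 'k::rc_field)"
proof (cases "c = 0")
  case False
  have "norm c * norm (scalar_conj c) = norm (c * scalar_conj c)"
    by (simp add: norm_mult)
  also have "\<dots> = norm c * norm c"
    unfolding mult_scalar_conj by (simp add: power2_eq_square)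
  finally show ?thesis
    using False by simp
qed (simp add: scalar_conj_0)

context separable_hilbert_space
begin

lemma ip_add_right: "ip x (y + z) = ip x y + ip x z"
  by (metis ip_add_left ip_commute scalar_conj_add)

lemma ip_0_left: "ip 0 x = 0"
  using ip_add_left[of 0 0 x] by simp

lemma ip_diff_left: "ip (x - y) z = ip x z - ip y z"
  using ip_add_left[of "x - y" y z] by simp

lemma ip_scaleR_left: "ip (r *\<^sub>R x) y = of_real r * ip x y"
  unfolding scl_of_real[symmetric] by (rule ip_scl_left)

lemma norm_ip_commute: "norm (ip x y) = norm (ip y x)"
  by (metis ip_commute norm_scalar_conj)

lemma ip_scaleR_right: "ip x (r *\<^sub>R y) = of_real r * ip x y"
  by (metis ip_commute ip_scaleR_left scalar_conj_mult scalar_conj_of_real)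

text \<open>The locale links \<open>inner\<close> and \<open>ip\<close> only through the norm
  (\<open>ip_self\<close>), so two expansions of the squared norm of \<open>x + y\<close> are
  compared.\<close>

lemma ip_polarization: "of_real (2 * inner x y) = ip x y + ip y x"
proof -
  have "of_real ((norm (x + y))\<^sup>2) = of_real ((norm x)\<^sup>2) + (ip x y + ip y x) + of_real ((norm y)\<^sup>2)"
    unfolding ip_self[symmetric] by (simp add: ip_add_left ip_add_right algebra_simps)
  moreover have "(norm (x + y))\<^sup>2 = (norm x)\<^sup>2 + 2 * inner x y + (norm y)\<^sup>2"
    by (simp add: power2_norm_eq_inner inner_add_left inner_add_right inner_commute)
  ultimately show ?thesis
    by (simp add: algebra_simps)
qed

text \<open>A real value of \<open>ip\<close> is fixed by conjugation, so the two summands in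
  \<open>ip_polarization\<close> coincide.\<close>

lemma inner_eqI: "ip x y = of_real r \<Longrightarrow> inner x y = r"
proof -
  assume r: "ip x y = of_real r"
  then have "(of_real (2 * inner x y) :: 'k) = of_real (2 * r)"
    unfolding ip_polarization ip_commute[of y x] by (simp add: scalar_conj_of_real)
  then show ?thesis
    unfolding of_real_eq_iff by simp
qed

text \<open>Turns the quadratic form of a frame operator into the sum of squared coefficients, term
  by term.\<close>

lemma inner_scl_ip: "inner (scl (ip f u) u) f = (norm (ip f u))\<^sup>2"
  by (rule inner_eqI)
    (simp add: ip_scl_left ip_commute[of u f] mult_scalar_conj scaleR_conv_of_real)

lemma abs_inner_le: "\<bar>inner x y\<bar> \<le> norm (ip x y)"
proof -
  have "2 * \<bar>inner x y\<bar> = norm (of_real (2 * inner x y) :: 'k)"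
    unfolding norm_of_real by simp
  also have "\<dots> \<le> norm (ip x y) + norm (ip y x)"
    unfolding ip_polarization by (rule norm_triangle_ineq)
  finally show ?thesis
    using norm_ip_commute[of y x] by simp
qed

lemma real_subspace: "closed_subspace scl U \<Longrightarrow> real_vector.subspace U"
  by (auto simp: closed_subspace_def real_vector.subspace_def subspace_def scl_of_real[symmetric])

text \<open>Real orthogonality is tested against \<open>scl (ip x u) u\<close>, which lies in
  \<open>U\<close> because \<open>U\<close> is closed under all scalars; the result is the squared
  norm of \<open>ip x u\<close>.\<close>

lemma ip_eq_0_on_subspace:
  assumes "closed_subspace scl U" and "\<And>u. u \<in> U \<Longrightarrow> inner u x = 0" and "u \<in> U"
  shows "ip x u = 0"
proof -
  have "scl (ip x u) u \<in> U"
    using assms(1,3) by (auto simp: closed_subspace_def subspace_scale)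
  then show ?thesis
    using assms(2) inner_scl_ip[of x u] by simp
qed

text \<open>Two candidates differ by a vector of \<open>U\<close> that is orthogonal to
  \<open>U\<close>, hence to itself; this resolves the \<open>THE\<close> in
  \<open>orth_proj\<close>.\<close>

lemma orth_proj_eqI:
  assumes U: "closed_subspace scl U" and p: "p \<in> U" "\<And>u. u \<in> U \<Longrightarrow> ip (f - p) u = 0"
  shows "orth_proj ip U f = p"
  unfolding orth_proj_def
proof (rule the_equality)
  fix q assume q: "q \<in> U \<and> (\<forall>u\<in>U. ip (f - q) u = 0)"
  have "p - q \<in> U"
    using U p q by (auto simp: closed_subspace_def subspace_diff)
  then have "ip ((f - q) - (f - p)) (p - q) = 0"
    unfolding ip_diff_left[of "f - q"] using p q by simp
  then have "ip (p - q) (p - q) = 0"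
    by simp
  then show "q = p"
    unfolding ip_self by simp
qed (use p in blast)

end

section \<open>Frames of closed subspaces\<close>

text \<open>Serves each local frame, with \<open>K = V i\<close>, and also the global frame, with
  \<open>K = UNIV\<close>.\<close>

locale subspace_frame = separable_hilbert_space scl ip
  for scl :: "'k::rc_field \<Rightarrow> 'h::{real_inner, complete_space} \<Rightarrow> 'h" and ip +
  fixes A B :: real and K :: "'h set" and J :: "'j set" and \<psi> :: "'j \<Rightarrow> 'h"
  assumes closed_subspace: "closed_subspace scl K"
    and frame: "frame_with_bounds ip A B K J \<psi>"
begin

lemma frame_bounds: "0 < A" "0 < B"
  and frame_mem: "j \<in> J \<Longrightarrow> \<psi> j \<in> K"
  and frame_lower: "f \<in> K \<Longrightarrow> A * (norm f)\<^sup>2 \<le> (\<Sum>\<^sub>\<infinity>j\<in>J. (norm (ip f (\<psi> j)))\<^sup>2)"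
  and frame_upper: "f \<in> K \<Longrightarrow> (\<Sum>\<^sub>\<infinity>j\<in>J. (norm (ip f (\<psi> j)))\<^sup>2) \<le> B * (norm f)\<^sup>2"
  and frame_summable: "f \<in> K \<Longrightarrow> (\<lambda>j. (norm (ip f (\<psi> j)))\<^sup>2) summable_on J"
  using frame by (auto simp: frame_with_bounds_def)

text \<open>The upper frame bound passes from analysis to its adjoint: \<open>x\<close> lies in
  \<open>K\<close>, so Cauchy-Schwarz and the bound on the coefficients of \<open>x\<close> estimate
  \<open>inner x x\<close>, and one factor \<open>norm x\<close> cancels.\<close>

lemma synthesis_bound:
  assumes F: "finite F" "F \<subseteq> J"
  shows "(norm (\<Sum>j\<in>F. scl (c j) (\<psi> j)))\<^sup>2 \<le> B * (\<Sum>j\<in>F. (norm (c j))\<^sup>2)"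
proof -
  define x where "x = (\<Sum>j\<in>F. scl (c j) (\<psi> j))"
  have K: "x \<in> K"
    using closed_subspace F frame_mem unfolding x_def closed_subspace_def
    by (auto intro!: subspace_sum subspace_scale)
  have "(\<Sum>j\<in>F. (norm (ip x (\<psi> j)))\<^sup>2) \<le> B * (norm x)\<^sup>2"
    by (rule order.trans[OF finite_sum_le_infsum[OF frame_summable[OF K] F] frame_upper[OF K]]) simp
  then have L2: "L2_set (\<lambda>j. norm (ip x (\<psi> j))) F \<le> sqrt B * norm x"
    unfolding L2_set_def using real_sqrt_le_mono by (fastforce simp: real_sqrt_mult)
  have "(norm x)\<^sup>2 = (\<Sum>j\<in>F. inner (scl (c j) (\<psi> j)) x)"
    unfolding power2_norm_eq_inner by (simp add: x_def inner_sum_left)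
  also have "\<dots> \<le> (\<Sum>j\<in>F. \<bar>norm (c j)\<bar> * \<bar>norm (ip x (\<psi> j))\<bar>)"
  proof (rule sum_mono)
    fix j
    show "inner (scl (c j) (\<psi> j)) x \<le> \<bar>norm (c j)\<bar> * \<bar>norm (ip x (\<psi> j))\<bar>"
      using abs_inner_le[of "scl (c j) (\<psi> j)" x]
      by (simp add: ip_scl_left norm_mult norm_ip_commute[of x])
  qed
  also have "\<dots> \<le> L2_set (\<lambda>j. norm (c j)) F * L2_set (\<lambda>j. norm (ip x (\<psi> j))) F"
    by (rule L2_set_mult_ineq)
  also have "\<dots> \<le> L2_set (\<lambda>j. norm (c j)) F * (sqrt B * norm x)"
    by (intro mult_left_mono L2 L2_set_nonneg)
  finally have "norm x * norm x \<le> (sqrt B * L2_set (\<lambda>j. norm (c j)) F) * norm x"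
    by (simp add: power2_eq_square mult_ac)
  moreover have "0 \<le> sqrt B * L2_set (\<lambda>j. norm (c j)) F"
    using frame_bounds by (simp add: L2_set_nonneg)
  ultimately have "norm x \<le> sqrt B * L2_set (\<lambda>j. norm (c j)) F"
    by (cases "norm x = 0") auto
  then have "(norm x)\<^sup>2 \<le> (sqrt B * L2_set (\<lambda>j. norm (c j)) F)\<^sup>2"
    by (intro power_mono) auto
  also have "\<dots> = B * (\<Sum>j\<in>F. (norm (c j))\<^sup>2)"
    using frame_bounds by (simp add: power_mult_distrib L2_set_def sum_nonneg)
  finally show ?thesis
    unfolding x_def .
qed

text \<open>The upper frame bound is assumed on \<open>K\<close> only, and no projection onto
  \<open>K\<close> is available yet. Since \<open>s = inner x f\<close>, Cauchy-Schwarz and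
  \<open>synthesis_bound\<close> give \<open>s\<^sup>2 \<le> B * s * (norm f)\<^sup>2\<close>, and
  \<open>s\<close> cancels.\<close>

lemma bessel:
  assumes F: "finite F" "F \<subseteq> J"
  shows "(\<Sum>j\<in>F. (norm (ip f (\<psi> j)))\<^sup>2) \<le> B * (norm f)\<^sup>2"
proof -
  define s where "s = (\<Sum>j\<in>F. (norm (ip f (\<psi> j)))\<^sup>2)"
  define x where "x = (\<Sum>j\<in>F. scl (ip f (\<psi> j)) (\<psi> j))"
  have s: "0 \<le> s"
    unfolding s_def by (intro sum_nonneg) simp
  have "s = inner x f"
    by (simp add: s_def x_def inner_sum_left inner_scl_ip)
  then have "s \<le> norm x * norm f"
    using norm_cauchy_schwarz by simp
  then have "s\<^sup>2 \<le> (norm x * norm f)\<^sup>2"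
    using s by (intro power_mono)
  also have "\<dots> = (norm x)\<^sup>2 * (norm f)\<^sup>2"
    by (rule power_mult_distrib)
  also have "\<dots> \<le> (B * s) * (norm f)\<^sup>2"
    unfolding x_def s_def by (intro mult_right_mono synthesis_bound F) simp
  finally have "s * s \<le> (B * (norm f)\<^sup>2) * s"
    by (simp add: power2_eq_square mult_ac)
  moreover have "0 \<le> B * (norm f)\<^sup>2"
    using frame_bounds by simp
  ultimately show ?thesis
    unfolding s_def[symmetric] using s by (cases "s = 0") auto
qed

lemma bessel_summable: "(\<lambda>j. (norm (ip f (\<psi> j)))\<^sup>2) summable_on J"
  by (rule nonneg_bdd_above_summable_on) (auto intro!: bdd_aboveI2 bessel)

section \<open>Convergence and bijectivity of the frame operator on a closed subspace\<close>

lemma frame_operator_summable: "(\<lambda>j. scl (ip f (\<psi> j)) (\<psi> j)) summable_on J"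
  by (rule summable_on_norm_square_bound(1)[OF bessel_summable _ _ synthesis_bound])
    (use frame_bounds in auto)

lemma frame_operator_has_sum:
  "((\<lambda>j. scl (ip f (\<psi> j)) (\<psi> j)) has_sum frame_operator scl ip J \<psi> f) J"
  unfolding frame_operator_def by (rule has_sum_infsum[OF frame_operator_summable])

lemma frame_operator_diff:
  "frame_operator scl ip J \<psi> (f - g) = frame_operator scl ip J \<psi> f - frame_operator scl ip J \<psi> g"
  by (rule has_sum_unique[OF frame_operator_has_sum])
    (use has_sum_diff[OF frame_operator_has_sum[of f] frame_operator_has_sum[of g]] in
      \<open>simp add: ip_diff_left scale_left_diff_distrib\<close>)

lemma frame_operator_mem: "frame_operator scl ip J \<psi> f \<in> K"
proof (rule Lim_in_closed_set[OF _ _ _ frame_operator_has_sum[unfolded has_sum_def]])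
  show "closed K"
    using closed_subspace by (simp add: closed_subspace_def)
  have "(\<Sum>j\<in>F. scl (ip f (\<psi> j)) (\<psi> j)) \<in> K" if "F \<subseteq> J" for F
    using closed_subspace that frame_mem unfolding closed_subspace_def
    by (auto intro!: subspace_sum subspace_scale)
  then show "\<forall>\<^sub>F F in finite_subsets_at_top J. (\<Sum>j\<in>F. scl (ip f (\<psi> j)) (\<psi> j)) \<in> K"
    by (intro eventually_finite_subsets_at_top_weakI)
qed simp

lemma frame_operator_bounded:
  assumes "f \<in> K"
  shows "(norm (frame_operator scl ip J \<psi> f))\<^sup>2 \<le> (B * B) * (norm f)\<^sup>2"
proof -
  have "(norm (frame_operator scl ip J \<psi> f))\<^sup>2 \<le> B * (\<Sum>\<^sub>\<infinity>j\<in>J. (norm (ip f (\<psi> j)))\<^sup>2)"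
    unfolding frame_operator_def
    by (rule summable_on_norm_square_bound(2)[OF bessel_summable _ _ synthesis_bound])
      (use frame_bounds in auto)
  also have "\<dots> \<le> B * (B * (norm f)\<^sup>2)"
    using frame_bounds frame_upper[OF assms] by (intro mult_left_mono) auto
  finally show ?thesis
    by simp
qed

text \<open>A bounded functional passes through the series. Holding for every \<open>f\<close>, this
  serves coercivity on \<open>K\<close> and the vanishing of coefficients outside
  \<open>K\<close>.\<close>

lemma inner_frame_operator:
  "((\<lambda>j. (norm (ip f (\<psi> j)))\<^sup>2) has_sum inner (frame_operator scl ip J \<psi> f) f) J"
  using has_sum_bounded_linear[OF bounded_linear_inner_left frame_operator_has_sum, of f f]
  by (simp add: inner_scl_ip)

lemma frame_operator_coercive:
  "f \<in> K \<Longrightarrow> A * (norm f)\<^sup>2 \<le> inner (frame_operator scl ip J \<psi> f) f"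
  using frame_lower infsumI[OF inner_frame_operator] by simp

lemma frame_operator_inj: "inj_on (frame_operator scl ip J \<psi>) K"
proof (rule inj_onI)
  fix f g
  assume fg: "f \<in> K" "g \<in> K" "frame_operator scl ip J \<psi> f = frame_operator scl ip J \<psi> g"
  have "f - g \<in> K"
    using closed_subspace fg by (auto simp: closed_subspace_def subspace_diff)
  then have "A * (norm (f - g))\<^sup>2 \<le> 0"
    using frame_operator_coercive[of "f - g"] fg by (simp add: frame_operator_diff)
  then show "f = g"
    using frame_bounds by (simp add: mult_le_0_iff)
qed

text \<open>The lower frame bound makes the operator coercive on \<open>K\<close>; the constant
  \<open>B * B\<close> combines \<open>synthesis_bound\<close> with the upper frame bound.\<close>

lemma frame_operator_surj: "y \<in> K \<Longrightarrow> \<exists>f\<in>K. frame_operator scl ip J \<psi> f = y"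
  by (rule coercive_surj[where M="B * B" and A=A])
    (use closed_subspace frame_bounds in
      \<open>auto simp: closed_subspace_def real_subspace frame_operator_mem frame_operator_diff
        intro: frame_operator_bounded frame_operator_coercive\<close>)

lemma frame_operator_inv:
  assumes "y \<in> K"
  shows "frame_operator_inv scl ip K J \<psi> y \<in> K"
    and "frame_operator scl ip J \<psi> (frame_operator_inv scl ip K J \<psi> y) = y"
proof -
  have "y \<in> frame_operator scl ip J \<psi> ` K"
    using frame_operator_surj[OF assms] by blast
  then show "frame_operator_inv scl ip K J \<psi> y \<in> K"
    and "frame_operator scl ip J \<psi> (frame_operator_inv scl ip K J \<psi> y) = y"
    unfolding frame_operator_inv_def by (auto intro: inv_into_into f_inv_into_f)
qed

text \<open>The frame operator makes sense on the whole space; the projection of \<open>f\<close> onto \<open>K\<close> is the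
  point of \<open>K\<close> at which it has the same value as at \<open>f\<close>.\<close>
lemma orth_proj_exists: "\<exists>p\<in>K. \<forall>u\<in>K. ip (f - p) u = 0"
proof -
  obtain p where p: "p \<in> K" "frame_operator scl ip J \<psi> p = frame_operator scl ip J \<psi> f"
    using frame_operator_surj[OF frame_operator_mem] by blast
  \<comment> \<open>Equal values at \<open>f\<close> and \<open>p\<close> make the quadratic form
    vanish at \<open>f - p\<close>, so its nonnegative terms are all 0.\<close>
  have "((\<lambda>j. (norm (ip (f - p) (\<psi> j)))\<^sup>2) has_sum 0) J"
    using inner_frame_operator[of "f - p"] p(2) by (simp add: frame_operator_diff)
  then have 0: "ip (f - p) (\<psi> j) = 0" if "j \<in> J" for j
    using nonneg_has_sum_le_0D[OF _ order.refl _ that] by fastforce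
  have "inner u (f - p) = 0" if u: "u \<in> K" for u
  proof -
    \<comment> \<open>As a value of the frame operator, \<open>u\<close> is a limit of combinations
      of the \<open>\<psi> j\<close>, to which \<open>f - p\<close> is orthogonal.\<close>
    obtain w where w: "w \<in> K" "frame_operator scl ip J \<psi> w = u"
      using frame_operator_surj[OF u] by blast
    have "inner (scl c (\<psi> j)) (f - p) = 0" if "j \<in> J" for c j
      using abs_inner_le[of "scl c (\<psi> j)" "f - p"] 0[OF that] norm_ip_commute[of "\<psi> j" "f - p"]
      by (simp add: ip_scl_left norm_mult)
    then have "((\<lambda>j. inner (scl (ip w (\<psi> j)) (\<psi> j)) (f - p)) has_sum 0) J"
      by (intro has_sum_0)
    then show ?thesis
      using has_sum_bounded_linear[OF bounded_linear_inner_left frame_operator_has_sum, of w "f - p"]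
        has_sum_unique w(2) by blast
  qed
  then show ?thesis
    using p(1) ip_eq_0_on_subspace[OF closed_subspace] by blast
qed

lemma orth_proj_mem: "orth_proj ip K f \<in> K"
  and ip_orth_proj: "u \<in> K \<Longrightarrow> ip (orth_proj ip K f) u = ip f u"
proof -
  obtain p where p: "p \<in> K" "\<forall>u\<in>K. ip (f - p) u = 0"
    using orth_proj_exists by blast
  then have "orth_proj ip K f = p"
    by (intro orth_proj_eqI closed_subspace) auto
  with p show "orth_proj ip K f \<in> K" "u \<in> K \<Longrightarrow> ip (orth_proj ip K f) u = ip f u"
    by (auto simp: ip_diff_left)
qed

lemma orth_proj_diff: "orth_proj ip K (f - g) = orth_proj ip K f - orth_proj ip K g"
  using closed_subspace
  by (intro orth_proj_eqI)
    (auto simp: closed_subspace_def ip_diff_left ip_orth_proj orth_proj_mem intro: subspace_diff)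

lemma inner_orth_proj: "inner (orth_proj ip K f) f = (norm (orth_proj ip K f))\<^sup>2"
proof (rule inner_eqI)
  have "ip f (orth_proj ip K f) = of_real ((norm (orth_proj ip K f))\<^sup>2)"
    using ip_orth_proj[OF orth_proj_mem, of f f] by (simp add: ip_self)
  then show "ip (orth_proj ip K f) f = of_real ((norm (orth_proj ip K f))\<^sup>2)"
    by (metis ip_commute scalar_conj_of_real)
qed

end

section \<open>Fusion frame systems\<close>

locale fusion_system = separable_hilbert_space scl ip
  for scl :: "'k::rc_field \<Rightarrow> 'h::{real_inner, complete_space} \<Rightarrow> 'h" and ip +
  fixes I :: "'i set" and V :: "'i \<Rightarrow> 'h set" and v :: "'i \<Rightarrow> real"
    and J :: "'i \<Rightarrow> 'j set" and \<phi> :: "'i \<Rightarrow> 'j \<Rightarrow> 'h" and A B A\<^sub>V B\<^sub>V :: real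
  assumes countable: "countable I"
    and subspaces: "i \<in> I \<Longrightarrow> closed_subspace scl (V i)"
    and weights: "i \<in> I \<Longrightarrow> 0 < v i"
    and fusion_bounds: "0 < A\<^sub>V" "A\<^sub>V \<le> B\<^sub>V"
    and fusion_summable: "(\<lambda>i. (v i)\<^sup>2 * (norm (orth_proj ip (V i) f))\<^sup>2) summable_on I"
    and fusion_lower: "A\<^sub>V * (norm f)\<^sup>2 \<le> (\<Sum>\<^sub>\<infinity>i\<in>I. (v i)\<^sup>2 * (norm (orth_proj ip (V i) f))\<^sup>2)"
    and fusion_upper: "(\<Sum>\<^sub>\<infinity>i\<in>I. (v i)\<^sup>2 * (norm (orth_proj ip (V i) f))\<^sup>2) \<le> B\<^sub>V * (norm f)\<^sup>2"
    and local_bounds: "0 < A" "A \<le> B"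
    and local_frames: "i \<in> I \<Longrightarrow> frame_with_bounds ip A B (V i) (J i) (\<phi> i)"
begin

lemma local_frame: "i \<in> I \<Longrightarrow> subspace_frame scl ip A B (V i) (J i) (\<phi> i)"
  using subspaces local_frames
  by (intro subspace_frame.intro subspace_frame_axioms.intro separable_hilbert_space_axioms)

text \<open>Since \<open>\<phi> i j\<close> lies in \<open>V i\<close>, it sees only the projection
  of \<open>f\<close>, and the local frame bounds become applicable to arbitrary
  \<open>f\<close>.\<close>

lemma ip_global_frame:
  assumes "i \<in> I" "j \<in> J i"
  shows "ip f (global_frame v \<phi> (i, j)) = of_real (v i) * ip (orth_proj ip (V i) f) (\<phi> i j)"
proof -
  interpret L: subspace_frame scl ip A B "V i" "J i" "\<phi> i"
    by (rule local_frame[OF assms(1)])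
  show ?thesis
    using assms by (simp add: global_frame_def ip_scaleR_right L.ip_orth_proj L.frame_mem)
qed

text \<open>Summing over \<open>j\<close> first applies the local bounds to the projection onto
  \<open>V i\<close>; summing over \<open>i\<close> then applies the fusion frame bounds, so the
  constants multiply.\<close>

lemma global_frame_with_bounds:
  "frame_with_bounds ip (A * A\<^sub>V) (B * B\<^sub>V) UNIV (Sigma I J) (global_frame v \<phi>)"
proof -
  define P where "P i f = orth_proj ip (V i) f" for i f
  define L where "L f i = (\<Sum>\<^sub>\<infinity>j\<in>J i. (norm (ip (P i f) (\<phi> i j)))\<^sup>2)" for f i
  have local_lower: "A * (norm (P i f))\<^sup>2 \<le> L f i"
    and local_upper: "L f i \<le> B * (norm (P i f))\<^sup>2"
    and local_sum: "((\<lambda>j. (norm (ip (P i f) (\<phi> i j)))\<^sup>2) has_sum L f i) (J i)"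
    if "i \<in> I" for i f
  proof -
    interpret L: subspace_frame scl ip A B "V i" "J i" "\<phi> i"
      by (rule local_frame[OF that])
    show "A * (norm (P i f))\<^sup>2 \<le> L f i" "L f i \<le> B * (norm (P i f))\<^sup>2"
      "((\<lambda>j. (norm (ip (P i f) (\<phi> i j)))\<^sup>2) has_sum L f i) (J i)"
      unfolding L_def P_def
      using L.frame_lower L.frame_upper L.frame_summable L.orth_proj_mem by auto
  qed
  have "(\<lambda>p. (norm (ip f (global_frame v \<phi> p)))\<^sup>2) summable_on Sigma I J \<and>
      A * A\<^sub>V * (norm f)\<^sup>2 \<le> (\<Sum>\<^sub>\<infinity>p\<in>Sigma I J. (norm (ip f (global_frame v \<phi> p)))\<^sup>2) \<and>
      (\<Sum>\<^sub>\<infinity>p\<in>Sigma I J. (norm (ip f (global_frame v \<phi> p)))\<^sup>2) \<le> B * B\<^sub>V * (norm f)\<^sup>2" for f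
  proof -
    define a where "a i = (v i)\<^sup>2 * (norm (P i f))\<^sup>2" for i
    have a: "a summable_on I" "A\<^sub>V * (norm f)\<^sup>2 \<le> infsum a I" "infsum a I \<le> B\<^sub>V * (norm f)\<^sup>2"
      unfolding a_def P_def using fusion_summable fusion_lower fusion_upper by auto
    have inner_sum: "((\<lambda>j. (norm (ip f (global_frame v \<phi> (i, j))))\<^sup>2) has_sum (v i)\<^sup>2 * L f i) (J i)"
      if "i \<in> I" for i
      using has_sum_cmult_right[OF local_sum[OF that], of "(v i)\<^sup>2"]
      by (rule has_sum_cong[THEN iffD1, rotated])
        (simp add: ip_global_frame that norm_mult power_mult_distrib P_def)
    have lower: "A * a i \<le> (v i)\<^sup>2 * L f i" if "i \<in> I" for i
      using mult_left_mono[OF local_lower[OF that], of "(v i)\<^sup>2" f] by (simp add: a_def mult_ac)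
    have upper: "(v i)\<^sup>2 * L f i \<le> B * a i" if "i \<in> I" for i
      using mult_left_mono[OF local_upper[OF that], of "(v i)\<^sup>2" f] by (simp add: a_def mult_ac)
    have outer: "(\<lambda>i. (v i)\<^sup>2 * L f i) summable_on I"
    proof (rule summable_on_comparison_test)
      show "(\<lambda>i. B * a i) summable_on I"
        by (intro summable_on_cmult_right a)
      show "0 \<le> (v i)\<^sup>2 * L f i" if "i \<in> I" for i
        unfolding L_def by (intro mult_nonneg_nonneg infsum_nonneg) auto
    qed (rule upper)
    \<comment> \<open>The terms are nonnegative, so summability of the iterated sums yields
      summability over the pairs.\<close>
    have summable: "(\<lambda>p. (norm (ip f (global_frame v \<phi> p)))\<^sup>2) summable_on Sigma I J"
      by (rule summable_on_SigmaI[OF inner_sum outer]) auto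
    have "(\<Sum>\<^sub>\<infinity>p\<in>Sigma I J. (norm (ip f (global_frame v \<phi> p)))\<^sup>2) = (\<Sum>\<^sub>\<infinity>i\<in>I. (v i)\<^sup>2 * L f i)"
      by (rule infsumI[OF has_sum_SigmaI[OF inner_sum has_sum_infsum[OF outer] summable]])
    moreover have "A * A\<^sub>V * (norm f)\<^sup>2 \<le> (\<Sum>\<^sub>\<infinity>i\<in>I. (v i)\<^sup>2 * L f i)"
    proof -
      have "A * A\<^sub>V * (norm f)\<^sup>2 \<le> A * infsum a I"
        using mult_left_mono[OF a(2), of A] local_bounds by (simp add: mult_ac)
      also have "\<dots> = (\<Sum>\<^sub>\<infinity>i\<in>I. A * a i)"
        by (simp add: infsum_cmult_right')
      also have "\<dots> \<le> (\<Sum>\<^sub>\<infinity>i\<in>I. (v i)\<^sup>2 * L f i)"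
        by (intro infsum_mono summable_on_cmult_right a outer lower)
      finally show ?thesis .
    qed
    moreover have "(\<Sum>\<^sub>\<infinity>i\<in>I. (v i)\<^sup>2 * L f i) \<le> B * B\<^sub>V * (norm f)\<^sup>2"
    proof -
      have "(\<Sum>\<^sub>\<infinity>i\<in>I. (v i)\<^sup>2 * L f i) \<le> (\<Sum>\<^sub>\<infinity>i\<in>I. B * a i)"
        by (intro infsum_mono summable_on_cmult_right a outer upper)
      also have "\<dots> = B * infsum a I"
        by (simp add: infsum_cmult_right')
      also have "\<dots> \<le> B * B\<^sub>V * (norm f)\<^sup>2"
        using mult_left_mono[OF a(3), of B] local_bounds by (simp add: mult_ac)
      finally show ?thesis .
    qed
    ultimately show ?thesis
      using summable by simp
  qed
  moreover have "countable (Sigma I J)"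
    using countable local_frames by (intro countable_SIGMA) (auto simp: frame_with_bounds_def)
  moreover have "A * A\<^sub>V \<le> B * B\<^sub>V"
    using fusion_bounds local_bounds by (intro mult_mono) auto
  ultimately show ?thesis
    using fusion_bounds local_bounds by (simp add: frame_with_bounds_def)
qed

text \<open>By \<open>ip_global_frame\<close> the coefficients of index \<open>k \<noteq> i\<close>
  vanish, leaving the local family at \<open>i\<close>.\<close>

lemma frame_operator_global_concentrated:
  assumes i: "i \<in> I" and h: "\<And>k. k \<in> I \<Longrightarrow> k \<noteq> i \<Longrightarrow> orth_proj ip (V k) h = 0"
  shows "frame_operator scl ip (Sigma I J) (global_frame v \<phi>) h =
    frame_operator scl ip (J i) (\<phi> i) ((v i)\<^sup>2 *\<^sub>R orth_proj ip (V i) h)"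
proof -
  let ?g = "\<lambda>p. scl (ip h (global_frame v \<phi> p)) (global_frame v \<phi> p)"
  have "infsum ?g (Sigma I J) = infsum ?g (Pair i ` J i)"
  proof (rule infsum_cong_neutral)
    fix p assume "p \<in> Sigma I J - Pair i ` J i"
    then obtain k j where "p = (k, j)" "k \<in> I" "j \<in> J k" "k \<noteq> i"
      by auto
    then show "?g p = 0"
      by (simp add: ip_global_frame h ip_0_left)
  qed (use i in auto)
  also have "\<dots> = infsum (?g \<circ> Pair i) (J i)"
    by (rule infsum_reindex) (simp add: inj_on_def)
  \<comment> \<open>One factor \<open>v i\<close> comes from the coefficient and one from the
    vector; together they form \<open>(v i)\<^sup>2\<close> in the argument.\<close>
  also have "\<dots> = (\<Sum>\<^sub>\<infinity>j\<in>J i. scl (ip ((v i)\<^sup>2 *\<^sub>R orth_proj ip (V i) h) (\<phi> i j)) (\<phi> i j))"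
    by (rule infsum_cong)
      (simp add: ip_global_frame i ip_scaleR_left, simp add: global_frame_def power2_eq_square
        scl_of_real[symmetric] mult_ac)
  finally show ?thesis
    unfolding frame_operator_def .
qed

end

section \<open>Fusion Riesz bases: unique expansions and preimages under the fusion frame
  operator\<close>

locale riesz_fusion_system = fusion_system +
  fixes \<alpha> \<beta> :: real
  assumes riesz_bounds: "0 < \<alpha>" "0 < \<beta>"
    and riesz_lower: "finite F \<Longrightarrow> F \<subseteq> I \<Longrightarrow> (\<And>j. j \<in> F \<Longrightarrow> f j \<in> V j) \<Longrightarrow>
      \<alpha> * (\<Sum>j\<in>F. (norm (f j))\<^sup>2) \<le> (norm (\<Sum>j\<in>F. v j *\<^sub>R f j))\<^sup>2"
    and riesz_upper: "finite F \<Longrightarrow> F \<subseteq> I \<Longrightarrow> (\<And>j. j \<in> F \<Longrightarrow> f j \<in> V j) \<Longrightarrow>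
      (norm (\<Sum>j\<in>F. v j *\<^sub>R f j))\<^sup>2 \<le> \<beta> * (\<Sum>j\<in>F. (norm (f j))\<^sup>2)"
begin

text \<open>By the lower Riesz bound, every finite partial sum containing index \<open>k\<close> has
  squared norm at least \<open>\<alpha> * (norm (f k))\<^sup>2\<close>, while these norms tend to
  0.\<close>

lemma riesz_unique:
  assumes mem: "\<And>k. k \<in> I \<Longrightarrow> f k \<in> V k" and sum: "((\<lambda>k. v k *\<^sub>R f k) has_sum 0) I"
    and k: "k \<in> I"
  shows "f k = 0"
proof -
  have "\<alpha> * (norm (f k))\<^sup>2 \<le> (norm (0 :: 'b))\<^sup>2"
  proof (rule tendsto_lowerbound)
    show "((\<lambda>F. (norm (\<Sum>k\<in>F. v k *\<^sub>R f k))\<^sup>2) \<longlongrightarrow> (norm (0 :: 'b))\<^sup>2) (finite_subsets_at_top I)"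
      using sum unfolding has_sum_def by (intro tendsto_intros)
    have "\<alpha> * (norm (f k))\<^sup>2 \<le> (norm (\<Sum>k\<in>F. v k *\<^sub>R f k))\<^sup>2"
      if F: "finite F" "{k} \<subseteq> F" "F \<subseteq> I" for F
    proof -
      have "(norm (f k))\<^sup>2 \<le> (\<Sum>k\<in>F. (norm (f k))\<^sup>2)"
        using F by (intro member_le_sum) auto
      then have "\<alpha> * (norm (f k))\<^sup>2 \<le> \<alpha> * (\<Sum>k\<in>F. (norm (f k))\<^sup>2)"
        using riesz_bounds by (intro mult_left_mono) auto
      also have "\<dots> \<le> (norm (\<Sum>k\<in>F. v k *\<^sub>R f k))\<^sup>2"
        using F mem by (intro riesz_lower) auto
      finally show ?thesis .
    qed
    then show "\<forall>\<^sub>F F in finite_subsets_at_top I. \<alpha> * (norm (f k))\<^sup>2 \<le> (norm (\<Sum>k\<in>F. v k *\<^sub>R f k))\<^sup>2"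
      unfolding eventually_finite_subsets_at_top using k by (intro exI[of _ "{k}"]) auto
  qed simp
  then show ?thesis
    using riesz_bounds by (simp add: mult_le_0_iff)
qed

text \<open>This is the upper Riesz bound at the vectors
  \<open>v i *\<^sub>R orth_proj ip (V i) f\<close>: one factor \<open>v i\<close> is the Riesz
  weight, the other belongs to the vector. It makes the fusion series converge.\<close>

lemma fusion_partial_sum_bound:
  assumes "finite F" "F \<subseteq> I"
  shows "(norm (\<Sum>i\<in>F. (v i)\<^sup>2 *\<^sub>R orth_proj ip (V i) f))\<^sup>2 \<le>
    \<beta> * (\<Sum>i\<in>F. (v i)\<^sup>2 * (norm (orth_proj ip (V i) f))\<^sup>2)"
proof -
  have "v i *\<^sub>R orth_proj ip (V i) f \<in> V i" if "i \<in> F" for i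
    using subspace_frame.orth_proj_mem[OF local_frame, of i f] assms that
      real_vector.subspace_scale[OF real_subspace[OF subspaces]] by blast
  from riesz_upper[OF assms this] show ?thesis
    by (simp add: power_mult_distrib) (simp add: power2_eq_square)
qed

lemma fusion_frame_operator_has_sum:
  "((\<lambda>i. (v i)\<^sup>2 *\<^sub>R orth_proj ip (V i) f) has_sum fusion_frame_operator ip I V v f) I"
  unfolding fusion_frame_operator_def
  by (intro has_sum_infsum summable_on_norm_square_bound(1)[OF fusion_summable _ _
    fusion_partial_sum_bound]) (use riesz_bounds in auto)

text \<open>Makes \<open>inv\<close> return genuine preimages. Boundedness combines the upper Riesz
  and upper fusion frame bounds; coercivity is the lower fusion frame bound read through
  \<open>inner_orth_proj\<close>.\<close>

lemma fusion_frame_operator_surj: "surj (fusion_frame_operator ip I V v)"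
  unfolding surj_def
proof
  fix y
  have "\<exists>x\<in>UNIV. fusion_frame_operator ip I V v x = y"
  proof (rule coercive_surj[where M="\<beta> * B\<^sub>V" and A=A\<^sub>V])
    show "fusion_frame_operator ip I V v (f - g) =
        fusion_frame_operator ip I V v f - fusion_frame_operator ip I V v g" for f g
    proof (rule has_sum_unique[OF fusion_frame_operator_has_sum])
      have "(v i)\<^sup>2 *\<^sub>R orth_proj ip (V i) f - (v i)\<^sup>2 *\<^sub>R orth_proj ip (V i) g =
          (v i)\<^sup>2 *\<^sub>R orth_proj ip (V i) (f - g)" if "i \<in> I" for i
        using subspace_frame.orth_proj_diff[OF local_frame[OF that], of f g]
        by (simp add: scaleR_diff_right)
      then show "((\<lambda>i. (v i)\<^sup>2 *\<^sub>R orth_proj ip (V i) (f - g)) has_sum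
          fusion_frame_operator ip I V v f - fusion_frame_operator ip I V v g) I"
        using has_sum_diff[OF fusion_frame_operator_has_sum[of f] fusion_frame_operator_has_sum[of g]]
        by (subst has_sum_cong[symmetric]) auto
    qed
    show "(norm (fusion_frame_operator ip I V v f))\<^sup>2 \<le> \<beta> * B\<^sub>V * (norm f)\<^sup>2" for f
    proof -
      have "(norm (fusion_frame_operator ip I V v f))\<^sup>2 \<le>
          \<beta> * (\<Sum>\<^sub>\<infinity>i\<in>I. (v i)\<^sup>2 * (norm (orth_proj ip (V i) f))\<^sup>2)"
        unfolding fusion_frame_operator_def
        by (rule summable_on_norm_square_bound(2)[OF fusion_summable _ _ fusion_partial_sum_bound])
          (use riesz_bounds in auto)
      also have "\<dots> \<le> \<beta> * (B\<^sub>V * (norm f)\<^sup>2)"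
        using riesz_bounds fusion_upper by (intro mult_left_mono) auto
      finally show ?thesis
        by simp
    qed
    show "A\<^sub>V * (norm f)\<^sup>2 \<le> inner (fusion_frame_operator ip I V v f) f" for f
    proof -
      have "((\<lambda>i. inner ((v i)\<^sup>2 *\<^sub>R orth_proj ip (V i) f) f) has_sum
          inner (fusion_frame_operator ip I V v f) f) I"
        by (rule has_sum_bounded_linear[OF bounded_linear_inner_left fusion_frame_operator_has_sum])
      then have "((\<lambda>i. (v i)\<^sup>2 * (norm (orth_proj ip (V i) f))\<^sup>2) has_sum
          inner (fusion_frame_operator ip I V v f) f) I"
        by (rule has_sum_cong[THEN iffD1, rotated])
          (simp add: subspace_frame.inner_orth_proj[OF local_frame])
      from infsumI[OF this] show ?thesis
        using fusion_lower[of f] by simp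
    qed
  qed (use riesz_bounds fusion_bounds in auto)
  then show "\<exists>x. y = fusion_frame_operator ip I V v x"
    by blast
qed

text \<open>Two expansions of \<open>f\<close> are compared: the fusion series at \<open>h\<close>
  and the single term \<open>f\<close> at index \<open>i\<close>.\<close>

lemma orth_proj_fusion_preimage:
  assumes i: "i \<in> I" and f: "f \<in> V i" and h: "fusion_frame_operator ip I V v h = f"
  shows "(v i)\<^sup>2 *\<^sub>R orth_proj ip (V i) h = f"
    and "k \<in> I \<Longrightarrow> k \<noteq> i \<Longrightarrow> orth_proj ip (V k) h = 0"
proof -
  \<comment> \<open>Difference of the Riesz coefficients of the two expansions;
    \<open>1 / v i\<close> offsets the weight, as the term of index \<open>k\<close> is
    \<open>v k *\<^sub>R d k\<close>.\<close>
  define d where "d k = v k *\<^sub>R orth_proj ip (V k) h - (if k = i then (1 / v i) *\<^sub>R f else 0)" for k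
  have "d k \<in> V k" if "k \<in> I" for k
    using that f subspace_frame.orth_proj_mem[OF local_frame, of k h] real_subspace[OF subspaces[OF that]]
    by (auto simp: d_def real_vector.subspace_0 intro!: real_vector.subspace_diff
      real_vector.subspace_scale)
  moreover have "((\<lambda>k. v k *\<^sub>R d k) has_sum 0) I"
  proof -
    have "((\<lambda>k. if k = i then f else 0) has_sum f) I"
      by (rule has_sum_cong_neutral[where S="{i}" and f="\<lambda>_. f", THEN iffD1]) (use i in \<open>auto intro: has_sum_finiteI\<close>)
    from has_sum_diff[OF fusion_frame_operator_has_sum[of h] this]
    have "((\<lambda>k. (v k)\<^sup>2 *\<^sub>R orth_proj ip (V k) h - (if k = i then f else 0)) has_sum 0) I"
      by (simp add: h)
    moreover have "(\<lambda>k. (v k)\<^sup>2 *\<^sub>R orth_proj ip (V k) h - (if k = i then f else 0)) = (\<lambda>k. v k *\<^sub>R d k)"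
      using weights[OF i] by (auto simp: d_def power2_eq_square scaleR_diff_right)
    ultimately show ?thesis
      by simp
  qed
  ultimately have d: "d k = 0" if "k \<in> I" for k
    using riesz_unique that by blast
  have "v i *\<^sub>R d i = 0"
    using d[OF i] by simp
  then show "(v i)\<^sup>2 *\<^sub>R orth_proj ip (V i) h = f"
    using weights[OF i] by (simp add: d_def power2_eq_square scaleR_diff_right)
  show "orth_proj ip (V k) h = 0" if "k \<in> I" "k \<noteq> i"
    using d[OF that(1)] that weights[OF that(1)] by (simp add: d_def)
qed

lemma canonical_dual_global_frame:
  assumes i: "i \<in> I" and j: "j \<in> J i"
  shows "canonical_dual scl ip UNIV (Sigma I J) (global_frame v \<phi>) (i, j) =
    inv (fusion_frame_operator ip I V v) (frame_operator_inv scl ip (V i) (J i) (\<phi> i) (v i *\<^sub>R \<phi> i j))"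
    (is "_ = inv _ ?f")
proof -
  interpret L: subspace_frame scl ip A B "V i" "J i" "\<phi> i"
    by (rule local_frame[OF i])
  interpret G: subspace_frame scl ip "A * A\<^sub>V" "B * B\<^sub>V" UNIV "Sigma I J" "global_frame v \<phi>"
    by unfold_locales (simp_all add: closed_subspace_def global_frame_with_bounds)
  define h where "h = inv (fusion_frame_operator ip I V v) ?f"
  have "v i *\<^sub>R \<phi> i j \<in> V i"
    using real_vector.subspace_scale[OF real_subspace[OF subspaces[OF i]]] L.frame_mem[OF j] by blast
  note f = L.frame_operator_inv[OF this]
  have "fusion_frame_operator ip I V v h = ?f"
    unfolding h_def by (rule surj_f_inv_f[OF fusion_frame_operator_surj])
  note proj = orth_proj_fusion_preimage[OF i f(1) this]
  \<comment> \<open>By \<open>proj\<close> the global operator at \<open>h\<close> equals the local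
    one at \<open>?f\<close>, which the local inverse sends back to
    \<open>v i *\<^sub>R \<phi> i j\<close>.\<close>
  have "frame_operator scl ip (Sigma I J) (global_frame v \<phi>) h = v i *\<^sub>R \<phi> i j"
    using frame_operator_global_concentrated[OF i proj(2)] proj(1) f(2) by simp
  \<comment> \<open>The value of the global frame at \<open>(i, j)\<close> is
    \<open>v i *\<^sub>R \<phi> i j\<close>, so injectivity identifies \<open>h\<close> with its
    preimage.\<close>
  then have "canonical_dual scl ip UNIV (Sigma I J) (global_frame v \<phi>) (i, j) = h"
    unfolding canonical_dual_def frame_operator_inv_def
    by (intro inv_into_f_eq G.frame_operator_inj) (auto simp: global_frame_def)
  then show ?thesis
    unfolding h_def .
qed

end

theorem theorem4p9:
  fixes scl :: "'k::rc_field \<Rightarrow> 'h::{real_inner, complete_space} \<Rightarrow> 'h"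
    and ip :: "'h \<Rightarrow> 'h \<Rightarrow> 'k"
    and I :: "'i set" and V :: "'i \<Rightarrow> 'h set" and v :: "'i \<Rightarrow> real"
    and J :: "'i \<Rightarrow> 'j set" and \<phi> :: "'i \<Rightarrow> 'j \<Rightarrow> 'h"
  assumes "separable_hilbert_space scl ip"
    and "fusion_frame_system scl ip I V v J \<phi>"
    and "fusion_riesz_basis scl I V v"
  shows "is_frame ip UNIV (Sigma I J) (global_frame v \<phi>) \<and>
    (\<forall>i\<in>I. \<forall>j\<in>J i.
       canonical_dual scl ip UNIV (Sigma I J) (global_frame v \<phi>) (i, j) =
       inv (fusion_frame_operator ip I V v)
         (frame_operator_inv scl ip (V i) (J i) (\<phi> i) (v i *\<^sub>R \<phi> i j)))"
proof -
  interpret separable_hilbert_space scl ip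
    by fact
  have V: "fusion_frame scl ip I V v"
    using assms(2) by (simp add: fusion_frame_system_def)
  obtain A\<^sub>V B\<^sub>V where fusion: "0 < A\<^sub>V" "A\<^sub>V \<le> B\<^sub>V"
    "\<forall>f. (\<lambda>i. (v i)\<^sup>2 * (norm (orth_proj ip (V i) f))\<^sup>2) summable_on I \<and>
      A\<^sub>V * (norm f)\<^sup>2 \<le> (\<Sum>\<^sub>\<infinity>i\<in>I. (v i)\<^sup>2 * (norm (orth_proj ip (V i) f))\<^sup>2) \<and>
      (\<Sum>\<^sub>\<infinity>i\<in>I. (v i)\<^sup>2 * (norm (orth_proj ip (V i) f))\<^sup>2) \<le> B\<^sub>V * (norm f)\<^sup>2"
    using V unfolding fusion_frame_def by (elim conjE exE) rule
  obtain A B where local: "0 < A" "A \<le> B" "\<forall>i\<in>I. frame_with_bounds ip A B (V i) (J i) (\<phi> i)"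
    using assms(2) unfolding fusion_frame_system_def by (elim conjE exE) rule
  obtain \<alpha> \<beta> where riesz: "0 < \<alpha>" "\<alpha> \<le> \<beta>"
    "\<forall>F f. finite F \<and> F \<subseteq> I \<and> (\<forall>j\<in>F. f j \<in> V j) \<longrightarrow>
      \<alpha> * (\<Sum>j\<in>F. (norm (f j))\<^sup>2) \<le> (norm (\<Sum>j\<in>F. v j *\<^sub>R f j))\<^sup>2 \<and>
      (norm (\<Sum>j\<in>F. v j *\<^sub>R f j))\<^sup>2 \<le> \<beta> * (\<Sum>j\<in>F. (norm (f j))\<^sup>2)"
    using assms(3) unfolding fusion_riesz_basis_def by (elim conjE exE) rule
  interpret fusion_system scl ip I V v J \<phi> A B A\<^sub>V B\<^sub>V
    by unfold_locales (use V fusion local in \<open>simp_all add: fusion_frame_def\<close>)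
  interpret riesz_fusion_system scl ip I V v J \<phi> A B A\<^sub>V B\<^sub>V \<alpha> \<beta>
    by unfold_locales (use riesz in simp_all)
  show ?thesis
    using global_frame_with_bounds canonical_dual_global_frame by (auto simp: is_frame_def)
qed

end
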